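(* Let $H_1,\ldots,H_n$ ($n\ge 2$) be (closed) subspaces of a complex Hilbert space $H$ and let $P_1,\ldots,P_n$ be the corresponding orthogonal projections. Then $H_1+\ldots+H_n$ is closed if and only if there exists $\varepsilon>0$ such that $\sigma(P_1+\ldots+P_n)\cap(0,\varepsilon)=\varnothing$.
   Context: "Subspace" means closed linear subspace; sums of subspaces are algebraic sums. $\sigma(A)$ denotes the spectrum of a bounded operator $A$. *)

theory Defs
  imports "HOL-Analysis.Analysis" "HOL-Library.Set_Algebras"
begin

section \<open>Complex Hilbert spaces\<close>

class complex_vector = real_vector +
  fixes scaleC :: "complex \<Rightarrow> 'a \<Rightarrow> 'a"  (infixr \<open>*\<^sub>C\<close> 75)
  assumes scaleC_add_right: "c *\<^sub>C (x + y) = c *\<^sub>C x + c *\<^sub>C y"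
    and scaleC_add_left: "(b + c) *\<^sub>C x = b *\<^sub>C x + c *\<^sub>C x"
    and scaleC_scaleC: "b *\<^sub>C c *\<^sub>C x = (b * c) *\<^sub>C x"
    and scaleC_one: "1 *\<^sub>C x = x"
    and scaleR_scaleC: "r *\<^sub>R x = complex_of_real r *\<^sub>C x"

text \<open>
  The complex inner product is linear in the first argument. Its real part is required to be the
  library's real inner product, so that positive definiteness, \<open>norm x = sqrt (Re (cinner x x))\<close> and
  the topology are inherited from \<^class>\<open>real_inner\<close>. Every complex inner product space is of
  this form, with \<open>inner x y = Re (cinner x y)\<close>.
\<close>

class complex_inner = complex_vector + real_inner +
  fixes cinner :: "'a \<Rightarrow> 'a \<Rightarrow> complex"
  assumes cinner_commute: "cinner x y = cnj (cinner y x)"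
    and cinner_add_left: "cinner (x + y) z = cinner x z + cinner y z"
    and cinner_scaleC_left: "cinner (c *\<^sub>C x) y = c * cinner x y"
    and inner_eq_Re_cinner: "inner x y = Re (cinner x y)"

class chilbert_space = complex_inner + complete_space

instantiation complex :: chilbert_space
begin

definition scaleC_complex :: "complex \<Rightarrow> complex \<Rightarrow> complex"
  where "scaleC_complex c x = c * x"

definition cinner_complex :: "complex \<Rightarrow> complex \<Rightarrow> complex"
  where "cinner_complex x y = x * cnj y"

instance
  by standard
    (auto simp: scaleC_complex_def cinner_complex_def inner_complex_def algebra_simps
      scaleR_conv_of_real)

end

lemma cinner_self: "cinner x x = complex_of_real ((norm x)\<^sup>2)"
  for x :: "'a::complex_inner"
proof (rule complex_eqI)
  show "Re (cinner x x) = Re (complex_of_real ((norm x)\<^sup>2))"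
    by (simp add: power2_norm_eq_inner inner_eq_Re_cinner)
  show "Im (cinner x x) = Im (complex_of_real ((norm x)\<^sup>2))"
    using arg_cong[OF cinner_commute[of x x], of Im] by simp
qed

global_interpretation complex_vector: vector_space "scaleC :: complex \<Rightarrow> 'a::complex_vector \<Rightarrow> 'a"
  defines csubspace = complex_vector.subspace
  by standard (rule scaleC_add_right scaleC_add_left scaleC_scaleC scaleC_one)+

definition closed_csubspace :: "'a::complex_inner set \<Rightarrow> bool"
  where "closed_csubspace M \<longleftrightarrow> csubspace M \<and> closed M"

text \<open>
  Sums of subspaces are the elementwise sums of sets from \<^theory>\<open>HOL-Library.Set_Algebras\<close>; over a
  finite index set these are the algebraic sums, see \<open>set_sum_alt\<close>.
\<close>


section \<open>Orthogonal projections\<close>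

definition orth_proj :: "'a::complex_inner set \<Rightarrow> 'a \<Rightarrow> 'a"
  where "orth_proj M x = (THE y. y \<in> M \<and> (\<forall>z\<in>M. cinner (x - y) z = 0))"

text \<open>The description above is proper for every closed subspace of a Hilbert space.\<close>

lemma orth_proj_ex1:
  fixes M :: "'a::chilbert_space set"
  assumes "closed_csubspace M"
  shows "\<exists>!y. y \<in> M \<and> (\<forall>z\<in>M. cinner (x - y) z = 0)"
proof -
  have sub: "csubspace M" and cl: "closed M"
    using assms by (auto simp: closed_csubspace_def)
  have zero: "0 \<in> M" and add: "\<And>u v. u \<in> M \<Longrightarrow> v \<in> M \<Longrightarrow> u + v \<in> M"
    and scale: "\<And>c u. u \<in> M \<Longrightarrow> c *\<^sub>C u \<in> M"
    using sub by (auto simp: complex_vector.subspace_def)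
  have scaleR: "r *\<^sub>R u \<in> M" if "u \<in> M" for r u
    using scale[OF that] by (simp add: scaleR_scaleC)
  have diff: "u - v \<in> M" if "u \<in> M" "v \<in> M" for u v
    using add[OF that(1) scaleR[OF that(2), of "-1"]] by simp
  define d where "d = infdist x M"
  have d0: "d \<ge> 0" by (simp add: d_def infdist_nonneg)
  have dle: "d \<le> norm (x - y)" if "y \<in> M" for y
    using infdist_le[OF that, of x] by (simp add: d_def dist_norm)
  have "\<exists>y\<in>M. norm (x - y) < d + inverse (real (Suc k))" for k
  proof -
    have "(INF y\<in>M. dist x y) < d + inverse (real (Suc k))"
      using zero by (auto simp: d_def infdist_def)
    then show ?thesis
      using zero by (subst (asm) cINF_less_iff) (auto simp: dist_norm intro!: bdd_belowI2[of _ 0])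
  qed
  then obtain y where yM: "\<And>k. y k \<in> M" and yd: "\<And>k. norm (x - y k) < d + inverse (real (Suc k))"
    by metis
  have est: "(norm (y m - y k))\<^sup>2 \<le> 2 * (d + e)\<^sup>2 + 2 * (d + e)\<^sup>2 - 4 * d\<^sup>2"
    if "inverse (real (Suc m)) \<le> e" "inverse (real (Suc k)) \<le> e" for m k e
  proof -
    have par: "(norm (y m - y k))\<^sup>2
        = 2 * (norm (x - y m))\<^sup>2 + 2 * (norm (x - y k))\<^sup>2 - 4 * (norm (x - (1/2) *\<^sub>R (y m + y k)))\<^sup>2"
      by (simp add: power2_norm_eq_inner algebra_simps inner_commute)
    have "d\<^sup>2 \<le> (norm (x - (1/2) *\<^sub>R (y m + y k)))\<^sup>2"
      by (intro power_mono dle scaleR add yM d0)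
    moreover have "(norm (x - y m))\<^sup>2 \<le> (d + e)\<^sup>2" "(norm (x - y k))\<^sup>2 \<le> (d + e)\<^sup>2"
      using yd[of m] yd[of k] that by (auto intro!: power_mono)
    ultimately show ?thesis unfolding par by linarith
  qed
  have "Cauchy y"
  proof (rule CauchyI)
    fix r :: real assume r: "r > 0"
    have "((\<lambda>e. 2 * (d + e)\<^sup>2 + 2 * (d + e)\<^sup>2 - 4 * d\<^sup>2) \<longlongrightarrow> 2 * (d + 0)\<^sup>2 + 2 * (d + 0)\<^sup>2 - 4 * d\<^sup>2) (at_right 0)"
      by (intro tendsto_intros)
    then have lim: "((\<lambda>e. 2 * (d + e)\<^sup>2 + 2 * (d + e)\<^sup>2 - 4 * d\<^sup>2) \<longlongrightarrow> 0) (at_right 0)"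
      by simp
    have "\<forall>\<^sub>F e in at_right (0::real). 2 * (d + e)\<^sup>2 + 2 * (d + e)\<^sup>2 - 4 * d\<^sup>2 < r\<^sup>2 \<and> 0 < e"
      using order_tendstoD(2)[OF lim, of "r\<^sup>2"] r eventually_at_right_less[of "0::real"]
      by (auto elim: eventually_elim2)
    then obtain e where e: "2 * (d + e)\<^sup>2 + 2 * (d + e)\<^sup>2 - 4 * d\<^sup>2 < r\<^sup>2" "0 < e"
      using eventually_happens trivial_limit_at_right_real by blast
    obtain N where N: "inverse (real (Suc N)) < e"
      using reals_Archimedean[OF e(2)] by blast
    have "norm (y m - y k) < r" if "m \<ge> N" "k \<ge> N" for m k
    proof -
      have "inverse (real (Suc j)) \<le> e" if "j \<ge> N" for j
      proof -
        have "inverse (real (Suc j)) \<le> inverse (real (Suc N))"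
          using that by (intro le_imp_inverse_le) auto
        with N show ?thesis by linarith
      qed
      then have "(norm (y m - y k))\<^sup>2 < r\<^sup>2"
        using est[of m e k] that e(1) by fastforce
      then show ?thesis using r by (simp add: power_less_imp_less_base)
    qed
    then show "\<exists>N. \<forall>m\<ge>N. \<forall>k\<ge>N. norm (y m - y k) < r" by blast
  qed
  then obtain p where lim: "y \<longlonglongrightarrow> p"
    using Cauchy_convergent convergent_def by blast
  have pM: "p \<in> M"
    using closed_sequentially[OF cl] yM lim by blast
  have "norm (x - p) \<le> d"
  proof (rule LIMSEQ_le)
    show "(\<lambda>k. norm (x - y k)) \<longlonglongrightarrow> norm (x - p)"
      by (intro tendsto_intros lim)
    show "(\<lambda>k. d + inverse (real (Suc k))) \<longlonglongrightarrow> d"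
      using tendsto_add[OF tendsto_const LIMSEQ_inverse_real_of_nat, of d] by simp
    show "\<exists>N. \<forall>k\<ge>N. norm (x - y k) \<le> d + inverse (real (Suc k))"
      using yd less_imp_le by blast
  qed
  then have min: "norm (x - p) \<le> norm (x - p - u)" if "u \<in> M" for u
    using dle[OF add[OF pM that]] by (simp add: algebra_simps)
  have re: "inner (x - p) z = 0" if "z \<in> M" for z
  proof (rule ccontr)
    assume nz: "inner (x - p) z \<noteq> 0"
    then have z: "inner z z > 0" by auto
    define t where "t = inner (x - p) z / inner z z"
    have "(norm (x - p))\<^sup>2 \<le> (norm (x - p - t *\<^sub>R z))\<^sup>2"
      by (intro power_mono min scaleR that) auto
    also have "\<dots> = (norm (x - p))\<^sup>2 - 2 * t * inner (x - p) z + t * (t * inner z z)"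
      unfolding power2_norm_eq_inner inner_diff_left[of "x - p" "t *\<^sub>R z"]
        inner_diff_right[of _ "x - p" "t *\<^sub>R z"]
      by (simp add: inner_commute[of z "x - p"])
    also have "t * inner z z = inner (x - p) z"
      using z by (simp add: t_def)
    finally have "t * inner (x - p) z \<le> 0" by simp
    then have "(inner (x - p) z)\<^sup>2 / inner z z \<le> 0"
      by (simp add: t_def power2_eq_square)
    moreover have "(inner (x - p) z)\<^sup>2 / inner z z > 0"
      using nz z by (intro divide_pos_pos) auto
    ultimately show False by linarith
  qed
  have orth: "cinner (x - p) z = 0" if "z \<in> M" for z
  proof (rule complex_eqI)
    show "Re (cinner (x - p) z) = Re 0"
      using re[OF that] by (simp add: inner_eq_Re_cinner)
    have "cinner (x - p) (\<i> *\<^sub>C z) = - \<i> * cinner (x - p) z"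
      by (metis cinner_commute cinner_scaleC_left complex_cnj_i complex_cnj_mult)
    moreover have "Re (cinner (x - p) (\<i> *\<^sub>C z)) = 0"
      using re[OF scale[OF that]] by (simp add: inner_eq_Re_cinner)
    ultimately show "Im (cinner (x - p) z) = Im 0" by simp
  qed
  show ?thesis
  proof (intro ex1I[of _ p] conjI ballI pM orth)
    fix q assume q: "q \<in> M \<and> (\<forall>z\<in>M. cinner (x - q) z = 0)"
    have "q - p \<in> M" using q pM diff by blast
    then have "inner (x - q) (q - p) = 0" "inner (x - p) (q - p) = 0"
      using q re by (auto simp: inner_eq_Re_cinner)
    then have "inner (q - p) (q - p) = 0"
      by (simp add: inner_diff_left)
    then show "q = p" by simp
  qed
qed


section \<open>Spectrum\<close>

definition bounded_clinear :: "('a::complex_inner \<Rightarrow> 'b::complex_inner) \<Rightarrow> bool"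
  where "bounded_clinear f \<longleftrightarrow>
    Vector_Spaces.linear scaleC scaleC f \<and> (\<exists>K. \<forall>x. norm (f x) \<le> K * norm x)"

definition spectrum :: "('a::complex_inner \<Rightarrow> 'a) \<Rightarrow> complex set"
  where "spectrum A =
    {l. \<not> (\<exists>B. bounded_clinear B \<and> (\<forall>x. B (A x - l *\<^sub>C x) = x) \<and> (\<forall>x. A (B x) - l *\<^sub>C B x = x))}"

end

theory Submission
  imports Defs
begin

text \<open>
  Let \<open>A = P\<^sub>1 + \<dots> + P\<^sub>n\<close> and \<open>S = H\<^sub>1 + \<dots> + H\<^sub>n\<close>, so that \<open>\<langle>A x, x\<rangle> = \<Sum> \<parallel>P\<^sub>i x\<parallel>\<^sup>2\<close>. Both conditions
  are equivalent to the existence of \<open>\<delta> > 0\<close> with \<open>\<delta> \<langle>A x, x\<rangle> \<le> \<parallel>A x\<parallel>\<^sup>2\<close> for all \<open>x\<close>.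
  This inequality with \<open>\<delta> = 2 \<lambda>\<close> says \<open>\<lambda> \<parallel>x\<parallel> \<le> \<parallel>(A - \<lambda>) x\<parallel>\<close>, which ties it to the spectrum.
  If \<open>S\<close> is closed, then \<open>{x \<in> S. \<langle>A x, x\<rangle> \<le> 1}\<close> is weakly bounded, hence bounded, so \<open>A\<close> is
  coercive on \<open>S\<close>, while it vanishes on the orthogonal complement. Conversely the inequality bounds
  \<open>A\<close> from below on the closure \<open>N\<close> of its range, and then \<open>S = A N\<close> is closed.
\<close>

section \<open>Operators on Hilbert spaces\<close>

lemma cinner_diff_left: "cinner (x - y) z = cinner x z - cinner y z"
  using cinner_add_left[of "x - y" y z] by simp

lemma cinner_scaleC_right: "cinner x (c *\<^sub>C y) = cnj c * cinner x y"
  by (metis cinner_commute cinner_scaleC_left complex_cnj_mult)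

lemma norm_scaleC: "norm (c *\<^sub>C x) = cmod c * norm x" for x :: "'a::complex_inner"
proof -
  have "complex_of_real ((norm (c *\<^sub>C x))\<^sup>2) = c * cnj c * complex_of_real ((norm x)\<^sup>2)"
    unfolding cinner_self[symmetric] cinner_scaleC_left cinner_scaleC_right by (simp add: mult.assoc)
  also have "c * cnj c = complex_of_real ((cmod c)\<^sup>2)"
    by (rule complex_norm_square[symmetric])
  finally have "(norm (c *\<^sub>C x))\<^sup>2 = (cmod c * norm x)\<^sup>2"
    by (simp add: power_mult_distrib flip: of_real_mult of_real_power)
  then show ?thesis by (simp add: power2_eq_iff_nonneg)
qed

lemma scaleC_diff_right: "c *\<^sub>C (x - y) = c *\<^sub>C x - c *\<^sub>C y"
  by (rule complex_vector.scale_right_diff_distrib)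

lemma bounded_clinearI:
  assumes "\<And>x y. f (x + y) = f x + f y" "\<And>c x. f (c *\<^sub>C x) = c *\<^sub>C f x"
    and "\<And>x. norm (f x) \<le> K * norm x"
  shows "bounded_clinear f"
  using assms unfolding bounded_clinear_def Vector_Spaces.linear_iff
  by (auto intro: complex_vector.vector_space_axioms)

lemma bounded_clinearD:
  assumes "bounded_clinear f"
  shows bounded_clinear_add: "f (x + y) = f x + f y"
    and bounded_clinear_scaleC: "f (c *\<^sub>C x) = c *\<^sub>C f x"
    and bounded_clinear_imp_bounded_linear: "bounded_linear f"
proof -
  have l: "Vector_Spaces.linear scaleC scaleC f"
    using assms by (simp add: bounded_clinear_def)
  show a: "f (x + y) = f x + f y" for x y
    by (rule Vector_Spaces.linear.axioms(3)[OF l, THEN module_hom.add])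
  show s: "f (c *\<^sub>C x) = c *\<^sub>C f x" for c x
    by (rule Vector_Spaces.linear.axioms(3)[OF l, THEN module_hom.scale])
  obtain K where "\<And>x. norm (f x) \<le> K * norm x"
    using assms by (auto simp: bounded_clinear_def)
  then show "bounded_linear f"
    by (intro bounded_linear_intro[of _ K]) (simp_all add: a s scaleR_scaleC mult.commute)
qed

lemma bounded_linear_scaleC_right: "bounded_linear (\<lambda>x::'a::complex_inner. c *\<^sub>C x)"
  by (rule bounded_clinear_imp_bounded_linear, rule bounded_clinearI[of _ "cmod c"])
    (auto simp: scaleC_add_right norm_scaleC complex_vector.scale_left_commute)

section \<open>Complex subspaces under closure, images and sums\<close>

lemma csubspace_imp_subspace: "csubspace M \<Longrightarrow> subspace M"
  unfolding complex_vector.subspace_def subspace_def by (simp add: scaleR_scaleC)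

lemma csubspace_closure:
  fixes M :: "'a::complex_inner set"
  assumes "csubspace M"
  shows "csubspace (closure M)"
proof -
  have add: "x + y \<in> closure M" if xy: "x \<in> closure M" "y \<in> closure M" for x y
  proof -
    obtain u v where uv: "\<And>k. u k \<in> M" "u \<longlonglongrightarrow> x" "\<And>k. v k \<in> M" "v \<longlonglongrightarrow> y"
      using xy unfolding closure_sequential by blast
    then have "(\<lambda>k. u k + v k) \<longlonglongrightarrow> x + y" "\<And>k. u k + v k \<in> M"
      using assms by (auto intro!: tendsto_add complex_vector.subspace_add)
    then show ?thesis
      unfolding closure_sequential by (intro exI[of _ "\<lambda>k. u k + v k"]) auto
  qed
  have "(\<lambda>x. c *\<^sub>C x) ` closure M \<subseteq> closure M" for c
    using assms closure_subset[of M]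
    by (intro image_closure_subset linear_continuous_on bounded_linear_scaleC_right)
      (auto simp: complex_vector.subspace_def)
  moreover have "0 \<in> closure M"
    using assms closure_subset by (auto simp: complex_vector.subspace_def)
  ultimately show ?thesis
    using add unfolding complex_vector.subspace_def by blast
qed

lemma csubspace_image:
  assumes "bounded_clinear f" "csubspace M"
  shows "csubspace (f ` M)"
proof -
  note f = bounded_clinear_add[OF assms(1)] bounded_clinear_scaleC[OF assms(1)]
  have "f 0 = 0" using f(2)[of 0 0] by simp
  with assms(2) show ?thesis
    unfolding complex_vector.subspace_def
    by (auto simp: f[symmetric] intro!: rev_image_eqI[of 0])
qed

lemma csubspace_sum:
  assumes "finite I" "\<And>i. i \<in> I \<Longrightarrow> csubspace (H i)"
  shows "csubspace (\<Sum>i\<in>I. H i)"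
  using assms
proof (induction I rule: finite_induct)
  case empty
  \<comment> \<open>The empty sum of sets is the singleton of the zero vector.\<close>
  then show ?case by (simp add: complex_vector.subspace_def)
next
  case (insert i I)
  have "H i + (\<Sum>i\<in>I. H i) = {x + y |x y. x \<in> H i \<and> y \<in> (\<Sum>i\<in>I. H i)}"
    by (auto simp: set_plus_def)
  then show ?case
    using insert complex_vector.subspace_sums[of "H i" "\<Sum>i\<in>I. H i"] by simp
qed

text \<open>The Banach--Steinhaus theorem for functionals represented by vectors.\<close>

lemma weakly_bounded_imp_bounded:
  fixes F :: "'a::{real_inner,complete_space} set"
  assumes "\<And>y. \<exists>K. \<forall>x\<in>F. \<bar>inner x y\<bar> \<le> K"
  shows "bounded F"
proof -
  define E where "E m = {y. \<forall>x\<in>F. \<bar>inner x y\<bar> \<le> real m}" for m :: nat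
  have "closed (E m)" for m
    unfolding E_def Collect_ball_eq
    by (intro closed_INT ballI closed_Collect_le continuous_intros)
  moreover have "(\<Union>m. E m) = UNIV"
  proof (intro set_eqI iffI UNIV_I)
    fix y :: 'a
    obtain K where K: "\<forall>x\<in>F. \<bar>inner x y\<bar> \<le> K" using assms by blast
    obtain m where "K \<le> real m" using real_arch_simple by blast
    with K have "y \<in> E m" unfolding E_def by (auto intro: order_trans)
    then show "y \<in> (\<Union>m. E m)" by blast
  qed
  \<comment> \<open>Baire: countably many closed sets cover a complete space, so one of them has
    interior.\<close>
  ultimately obtain m where "interior (E m) \<noteq> {}"
    using Baire_category_alt[of "euclidean :: 'a topology" "range E"]
      completely_metrizable_space_euclidean by fastforce
  then obtain y0 where "y0 \<in> interior (E m)" by blast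
  then obtain r where r: "r > 0" "cball y0 r \<subseteq> E m"
    unfolding mem_interior_cball by blast
  have "norm x \<le> 2 * real m / r" if "x \<in> F" for x
  proof (cases "x = 0")
    case False
    \<comment> \<open>The shift of \<open>y0\<close> has length exactly \<open>r\<close>, so both
      points lie in the ball. Subtracting their two bounds leaves
      \<open>r * norm x \<le> 2 * m\<close>.\<close>
    have "y0 \<in> E m" "y0 + (r / norm x) *\<^sub>R x \<in> E m"
      using r False by (auto simp: dist_norm intro!: subsetD[OF r(2)])
    with that have "\<bar>inner x y0\<bar> \<le> m" "\<bar>inner x y0 + r / norm x * inner x x\<bar> \<le> m"
      by (auto simp: E_def inner_add_right)
    then have "r / norm x * inner x x \<le> 2 * m" by linarith
    then show ?thesis
      using False r(1) by (simp add: field_simps power2_eq_square dot_square_norm)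
  qed (use r in simp)
  then show ?thesis by (auto simp: bounded_iff)
qed

section \<open>Orthogonal projections\<close>

lemma orth_proj_mem:
  fixes M :: "'a::chilbert_space set"
  assumes "closed_csubspace M"
  shows "orth_proj M x \<in> M"
  using theI'[OF orth_proj_ex1[OF assms, of x]] by (simp add: orth_proj_def)

lemma cinner_diff_orth_proj:
  fixes M :: "'a::chilbert_space set"
  assumes "closed_csubspace M" "z \<in> M"
  shows "cinner (x - orth_proj M x) z = 0"
  using theI'[OF orth_proj_ex1[OF assms(1), of x]] assms(2) by (simp add: orth_proj_def)

lemma orth_proj_eqI:
  fixes M :: "'a::chilbert_space set"
  assumes "closed_csubspace M" "y \<in> M" "\<And>z. z \<in> M \<Longrightarrow> cinner (x - y) z = 0"
  shows "orth_proj M x = y"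
  unfolding orth_proj_def
  by (rule the1_equality[OF orth_proj_ex1[OF assms(1)]]) (use assms(2,3) in blast)

lemma inner_orth_proj_left:
  fixes M :: "'a::chilbert_space set"
  assumes "closed_csubspace M" "z \<in> M"
  shows "inner (orth_proj M x) z = inner x z"
  using cinner_diff_orth_proj[OF assms, of x] by (simp add: inner_eq_Re_cinner cinner_diff_left)

lemma orth_proj_selfadjoint:
  fixes M :: "'a::chilbert_space set"
  assumes "closed_csubspace M"
  shows "inner (orth_proj M x) y = inner x (orth_proj M y)"
  using inner_orth_proj_left[OF assms orth_proj_mem[OF assms, of x], of y]
    inner_orth_proj_left[OF assms orth_proj_mem[OF assms, of y], of x]
  by (simp add: inner_commute)

lemma inner_orth_proj_self:
  fixes M :: "'a::chilbert_space set"
  assumes "closed_csubspace M"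
  shows "inner (orth_proj M x) x = (norm (orth_proj M x))\<^sup>2"
  using inner_orth_proj_left[OF assms orth_proj_mem[OF assms, of x], of x]
  by (simp add: inner_commute power2_norm_eq_inner)

lemma bounded_clinear_orth_proj:
  fixes M :: "'a::chilbert_space set"
  assumes M: "closed_csubspace M"
  shows "bounded_clinear (orth_proj M)"
proof (rule bounded_clinearI)
  have sub: "csubspace M" using M by (simp add: closed_csubspace_def)
  have orth: "cinner (orth_proj M x) z = cinner x z" if "z \<in> M" for x z
    using cinner_diff_orth_proj[OF M that, of x] by (simp add: cinner_diff_left)
  show "orth_proj M (x + y) = orth_proj M x + orth_proj M y" for x y
    by (intro orth_proj_eqI M complex_vector.subspace_add[OF sub] orth_proj_mem)
      (simp add: cinner_diff_left cinner_add_left orth)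
  show "orth_proj M (c *\<^sub>C x) = c *\<^sub>C orth_proj M x" for c x
    by (intro orth_proj_eqI M complex_vector.subspace_scale[OF sub] orth_proj_mem)
      (simp add: cinner_diff_left cinner_scaleC_left orth)
  show "norm (orth_proj M x) \<le> 1 * norm x" for x
  proof -
    have "(norm (orth_proj M x))\<^sup>2 \<le> norm (orth_proj M x) * norm x"
      using norm_cauchy_schwarz[of "orth_proj M x" x] inner_orth_proj_self[OF M, of x] by simp
    then show ?thesis
      by (cases "orth_proj M x = 0") (simp_all add: power2_eq_square)
  qed
qed

section \<open>Real spectral points of selfadjoint operators\<close>

text \<open>The lower bound makes the range complete, hence closed, and makes the kernel trivial.
  For selfadjoint \<open>f\<close> a vector orthogonal to the range lies in the kernel, so the range
  is everything.\<close>

lemma selfadjoint_bounded_below_surj: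
  fixes f :: "'a::chilbert_space \<Rightarrow> 'a"
  assumes f: "bounded_clinear f" and sa: "\<And>x y. inner (f x) y = inner x (f y)"
    and c: "c > 0" "\<And>x. c * norm x \<le> norm (f x)"
  shows "surj f"
proof -
  have "complete (range f)"
    using c by (intro complete_isometric_image[of c] bounded_clinear_imp_bounded_linear f)
      (auto simp: complete_UNIV)
  then have R: "closed_csubspace (range f)"
    by (simp add: closed_csubspace_def complete_imp_closed csubspace_image[OF f])
  have "y = orth_proj (range f) y" for y
  proof -
    define w where "w = y - orth_proj (range f) y"
    \<comment> \<open>Testing \<open>w\<close> against \<open>f (f w)\<close> turns orthogonality
      into \<open>inner (f w) (f w) = 0\<close>.\<close>
    have "inner w (f (f w)) = 0"
      using cinner_diff_orth_proj[OF R] by (simp add: w_def inner_eq_Re_cinner)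
    then have "f w = 0" using sa[of w "f w"] by simp
    then have "w = 0" using c(1) c(2)[of w] by (simp add: mult_le_0_iff)
    then show ?thesis by (simp add: w_def)
  qed
  then show ?thesis using orth_proj_mem[OF R] by (metis UNIV_eq_I)
qed

text \<open>A bounded inverse with constant \<open>K\<close> yields \<open>c = inverse K\<close>.
  Conversely the bound makes \<open>A - t\<close> injective and, by selfadjointness, surjective; the
  inverse is then bounded by \<open>inverse c\<close>.\<close>

lemma not_in_spectrum_selfadjoint_iff:
  fixes A :: "'a::chilbert_space \<Rightarrow> 'a"
  assumes A: "bounded_clinear A" and sa: "\<And>x y. inner (A x) y = inner x (A y)"
  shows "complex_of_real t \<notin> spectrum A \<longleftrightarrow> (\<exists>c>0. \<forall>x. c * norm x \<le> norm (A x - t *\<^sub>R x))"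
proof
  assume "complex_of_real t \<notin> spectrum A"
  then obtain B where B: "bounded_clinear B" "\<And>x. B (A x - t *\<^sub>R x) = x"
    by (auto simp: spectrum_def scaleR_scaleC)
  obtain K where K: "K > 0" "\<And>x. norm (B x) \<le> norm x * K"
    using bounded_linear.pos_bounded[OF bounded_clinear_imp_bounded_linear[OF B(1)]] by blast
  have "inverse K * norm x \<le> norm (A x - t *\<^sub>R x)" for x
    using K(2)[of "A x - t *\<^sub>R x"] K(1) by (simp add: B(2) field_simps)
  with K(1) show "\<exists>c>0. \<forall>x. c * norm x \<le> norm (A x - t *\<^sub>R x)"
    by (intro exI[of _ "inverse K"]) auto
next
  assume "\<exists>c>0. \<forall>x. c * norm x \<le> norm (A x - t *\<^sub>R x)"
  then obtain c where c: "c > 0" "\<And>x. c * norm x \<le> norm (A x - t *\<^sub>R x)" by blast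
  define f where "f x = A x - t *\<^sub>R x" for x
  obtain K where K: "\<And>x. norm (A x) \<le> norm x * K"
    using bounded_linear.bounded[OF bounded_clinear_imp_bounded_linear[OF A]] by blast
  have f: "bounded_clinear f"
  proof (rule bounded_clinearI)
    show "norm (f x) \<le> (K + \<bar>t\<bar>) * norm x" for x
      using norm_triangle_ineq4[of "A x" "t *\<^sub>R x"] K[of x] by (simp add: f_def algebra_simps)
  qed (simp_all add: f_def bounded_clinear_add[OF A] bounded_clinear_scaleC[OF A]
      scaleC_diff_right scaleR_scaleC scaleC_scaleC scaleC_add_right mult.commute)
  have "surj f"
    by (rule selfadjoint_bounded_below_surj[OF f _ c(1)])
      (use c(2) in \<open>simp_all add: f_def inner_diff_left inner_diff_right sa\<close>)
  then have fB: "f (inv f y) = y" for y by (simp add: surj_f_inv_f)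
  have "x = y" if "f x = f y" for x y
  proof -
    have "f (x - y) = 0"
      using that by (simp add: linear_diff[OF bounded_linear.linear]
          bounded_clinear_imp_bounded_linear[OF f])
    then have "c * norm (x - y) \<le> 0" using c(2)[of "x - y"] by (simp add: f_def)
    then show ?thesis using c(1) by (simp add: mult_le_0_iff)
  qed
  then have inj: "inj f" by (rule injI)
  have "bounded_clinear (inv f)"
  proof (rule bounded_clinearI)
    show "norm (inv f y) \<le> inverse c * norm y" for y
      using c(1) c(2)[of "inv f y"] fB[of y] by (simp add: f_def field_simps)
  qed (auto intro!: inv_f_eq[OF inj] simp: fB bounded_clinear_add[OF f] bounded_clinear_scaleC[OF f])
  then show "complex_of_real t \<notin> spectrum A"
    using fB inv_f_f[OF inj] unfolding f_def spectrum_def scaleR_scaleC by blast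
qed

section \<open>Positive operators and the estimate inside a spectral gap\<close>

text \<open>Positivity is tested at \<open>x - t *\<^sub>R G x\<close>. The result converts a lower
  bound on \<open>norm (G x)\<close> into one on the quadratic form of \<open>G\<close>.\<close>

lemma positive_selfadjoint_norm_bound:
  fixes G :: "'a::real_inner \<Rightarrow> 'a"
  assumes G: "bounded_linear G" and sa: "\<And>x y. inner (G x) y = inner x (G y)"
    and pos: "\<And>x. inner (G x) x \<ge> 0"
    and K: "K > 0" "\<And>x. norm (G x) \<le> norm x * K"
  shows "(norm (G x))\<^sup>2 \<le> K * inner (G x) x"
proof -
  interpret G: bounded_linear G by fact
  \<comment> \<open>This \<open>t\<close> minimises \<open>inner (G x) x - 2 * t * (norm (G
    x))\<^sup>2 + t\<^sup>2 * K * (norm (G x))\<^sup>2\<close>.\<close>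
  define t where "t = inverse K"
  have "0 \<le> inner (G (x - t *\<^sub>R G x)) (x - t *\<^sub>R G x)" by (rule pos)
  also have "\<dots> = inner (G x) x - 2 * t * (norm (G x))\<^sup>2 + t\<^sup>2 * inner (G (G x)) (G x)"
    by (simp add: G.diff G.scaleR inner_diff_left inner_diff_right sa[of "G x" x]
        dot_square_norm power2_eq_square algebra_simps)
  also have "inner (G (G x)) (G x) \<le> K * (norm (G x))\<^sup>2"
    using norm_cauchy_schwarz[of "G (G x)" "G x"] mult_right_mono[OF K(2)[of "G x"], of "norm (G x)"]
    by (simp add: power2_eq_square mult.commute mult.left_commute)
  finally have "2 * t * (norm (G x))\<^sup>2 \<le> inner (G x) x + t\<^sup>2 * (K * (norm (G x))\<^sup>2)"
    by (simp add: mult_left_mono)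
  then show ?thesis using K(1) by (simp add: t_def field_simps power2_eq_square)
qed

text \<open>
  For the largest \<open>s \<le> \<lambda>\<^sup>2\<close> with \<open>s \<parallel>x\<parallel>\<^sup>2 \<le> \<parallel>(A - \<lambda>) x\<parallel>\<^sup>2\<close>, the positive operator
  \<open>(A - \<lambda>)\<^sup>2 - s = (A - \<lambda> + \<surd>s) (A - \<lambda> - \<surd>s)\<close> would be bounded below if \<open>s < \<lambda>\<^sup>2\<close>,
  so \<open>s\<close> could be enlarged.
\<close>

lemma selfadjoint_bounded_below_of_gap:
  fixes A :: "'a::real_inner \<Rightarrow> 'a"
  assumes A: "bounded_linear A" and sa: "\<And>x y. inner (A x) y = inner x (A y)"
    and gap: "\<And>t. 0 < t \<Longrightarrow> t < 2 * l \<Longrightarrow> \<exists>c>0. \<forall>x. c * norm x \<le> norm (A x - t *\<^sub>R x)"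
    and l: "l > 0"
  shows "l * norm x \<le> norm (A x - l *\<^sub>R x)"
proof -
  interpret A: bounded_linear A by fact
  define L where "L x = A x - l *\<^sub>R x" for x
  have L: "bounded_linear L"
    unfolding L_def by (intro bounded_linear_sub A bounded_linear_scaleR_right)
  have saL: "inner (L x) y = inner x (L y)" for x y
    by (simp add: L_def inner_diff_left inner_diff_right sa)
  \<comment> \<open>The cap \<open>l\<^sup>2\<close> bounds \<open>M\<close> above and keeps
    \<open>sqrt s\<close> at most \<open>l\<close>.\<close>
  define M where "M = {s. 0 \<le> s \<and> s \<le> l\<^sup>2 \<and> (\<forall>x. s * (norm x)\<^sup>2 \<le> (norm (L x))\<^sup>2)}"
  have M0: "0 \<in> M" by (simp add: M_def)
  then have ne: "M \<noteq> {}" by blast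
  have bdd: "bdd_above M" by (auto simp: M_def bdd_above_def)
  define s where "s = Sup M"
  \<comment> \<open>The supremum is attained, since each defining inequality of \<open>M\<close> is
    preserved under suprema.\<close>
  have sM: "s \<in> M"
  proof -
    have "0 \<le> s" unfolding s_def using M0 bdd by (rule cSup_upper)
    moreover have "s \<le> l\<^sup>2"
      unfolding s_def by (rule cSup_least[OF ne]) (auto simp: M_def)
    moreover have "s * (norm x)\<^sup>2 \<le> (norm (L x))\<^sup>2" for x
    proof (cases "x = 0")
      case False
      have "s \<le> (norm (L x))\<^sup>2 / (norm x)\<^sup>2"
        unfolding s_def using False by (intro cSup_least[OF ne]) (auto simp: M_def field_simps)
      with False show ?thesis by (simp add: field_simps)
    qed simp
    ultimately show ?thesis by (simp add: M_def)
  qed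
  have "s = l\<^sup>2"
  proof (rule ccontr)
    assume "s \<noteq> l\<^sup>2"
    with sM have s: "0 \<le> s" "s < l\<^sup>2" by (auto simp: M_def)
    \<comment> \<open>As \<open>0 \<le> m < l\<close>, both \<open>l - m\<close> and
      \<open>l + m\<close> lie strictly between \<open>0\<close> and \<open>2 * l\<close>, where the
      gap hypothesis applies.\<close>
    define m where "m = sqrt s"
    have m: "0 \<le> m" "m < l" "m\<^sup>2 = s"
      using s l by (auto simp: m_def real_less_lsqrt)
    obtain c d where c: "c > 0" "\<And>x. c * norm x \<le> norm (A x - (l - m) *\<^sub>R x)"
      and d: "d > 0" "\<And>x. d * norm x \<le> norm (A x - (l + m) *\<^sub>R x)"
      using gap[of "l - m"] gap[of "l + m"] m l by auto
    define G where "G x = L (L x) - s *\<^sub>R x" for x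
    have G: "bounded_linear G"
      unfolding G_def
      by (intro bounded_linear_sub bounded_linear_compose[OF L] L bounded_linear_scaleR_right)
    have saG: "inner (G x) y = inner x (G y)" for x y
      by (simp add: G_def inner_diff_left inner_diff_right saL)
    have GL: "inner (G x) x = (norm (L x))\<^sup>2 - s * (norm x)\<^sup>2" for x
      by (simp add: G_def inner_diff_left saL power2_norm_eq_inner)
    have lower: "c * d * norm x \<le> norm (G x)" for x
    proof -
      define y where "y = A x - (l + m) *\<^sub>R x"
      have "G x = A y - (l - m) *\<^sub>R y"
        by (simp add: G_def L_def y_def A.add A.diff A.scaleR algebra_simps flip: m(3))
          (simp add: power2_eq_square)
      moreover have "c * (d * norm x) \<le> c * norm y"
        using c(1) d(2) unfolding y_def by (intro mult_left_mono) auto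
      ultimately show ?thesis using c(2)[of y] by simp
    qed
    obtain K where K: "K > 0" "\<And>x. norm (G x) \<le> norm x * K"
      using bounded_linear.pos_bounded[OF G] by blast
    \<comment> \<open>The gain comes from \<open>(c * d * norm x)\<^sup>2 \<le> (norm (G x))\<^sup>2
      \<le> K * inner (G x) x\<close>; membership of \<open>s\<close> in \<open>M\<close> is what
      makes \<open>G\<close> positive.\<close>
    have "(s + (c * d)\<^sup>2 / K) * (norm x)\<^sup>2 \<le> (norm (L x))\<^sup>2" for x
    proof -
      have "(c * d * norm x)\<^sup>2 \<le> (norm (G x))\<^sup>2"
        using lower c(1) d(1) by (intro power_mono) auto
      also have "\<dots> \<le> K * ((norm (L x))\<^sup>2 - s * (norm x)\<^sup>2)"
        unfolding GL[symmetric] using sM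
        by (intro positive_selfadjoint_norm_bound G saG K) (simp add: GL M_def)
      finally show ?thesis using K(1) by (simp add: field_simps power_mult_distrib)
    qed
    then have "min (l\<^sup>2) (s + (c * d)\<^sup>2 / K) * (norm x)\<^sup>2 \<le> (norm (L x))\<^sup>2" for x
      by (meson min.cobounded2 mult_right_mono order_trans zero_le_power2)
    moreover have "0 \<le> s + (c * d)\<^sup>2 / K" using s K(1) by simp
    ultimately have "min (l\<^sup>2) (s + (c * d)\<^sup>2 / K) \<in> M"
      by (simp add: M_def)
    then have "min (l\<^sup>2) (s + (c * d)\<^sup>2 / K) \<le> s"
      unfolding s_def using bdd by (rule cSup_upper)
    moreover have "(c * d)\<^sup>2 / K > 0" using c(1) d(1) K(1) by simp
    ultimately show False using s(2) by linarith
  qed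
  then have "(l * norm x)\<^sup>2 \<le> (norm (L x))\<^sup>2"
    using sM by (simp add: M_def power_mult_distrib)
  then show ?thesis unfolding L_def by (rule power2_le_imp_le) simp
qed


section \<open>Sums of orthogonal projections\<close>

locale projection_sum =
  fixes H :: "'i \<Rightarrow> 'a::chilbert_space set" and I :: "'i set"
  assumes fin: "finite I" and sub: "\<And>i. i \<in> I \<Longrightarrow> closed_csubspace (H i)"
begin

definition A :: "'a \<Rightarrow> 'a" where "A x = (\<Sum>i\<in>I. orth_proj (H i) x)"

abbreviation S :: "'a set" where "S \<equiv> \<Sum>i\<in>I. H i"

lemma A_bounded_clinear: "bounded_clinear A"
proof -
  have "bounded_linear A"
    unfolding A_def using sub
    by (intro bounded_linear_sum bounded_clinear_imp_bounded_linear bounded_clinear_orth_proj)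
  then obtain K where "\<And>x. norm (A x) \<le> norm x * K"
    using bounded_linear.bounded by blast
  then have "\<And>x. norm (A x) \<le> K * norm x"
    by (simp add: mult.commute)
  then show ?thesis
  proof (rule bounded_clinearI[rotated 2])
    show "A (x + y) = A x + A y" for x y
      unfolding A_def using bounded_clinear_add[OF bounded_clinear_orth_proj[OF sub]]
      by (simp add: sum.distrib)
    show "A (c *\<^sub>C x) = c *\<^sub>C A x" for c x
      unfolding A_def using bounded_clinear_scaleC[OF bounded_clinear_orth_proj[OF sub]]
      by (simp add: complex_vector.scale_sum_right)
  qed
qed

sublocale A: bounded_linear A
  by (rule bounded_clinear_imp_bounded_linear[OF A_bounded_clinear])

lemma A_selfadjoint: "inner (A x) y = inner x (A y)"
  unfolding A_def inner_sum_left inner_sum_right by (intro sum.cong orth_proj_selfadjoint sub) auto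

lemma inner_A_self: "inner (A x) x = (\<Sum>i\<in>I. (norm (orth_proj (H i) x))\<^sup>2)"
  unfolding A_def inner_sum_left by (intro sum.cong inner_orth_proj_self sub) auto

lemma inner_A_nonneg: "0 \<le> inner (A x) x"
  unfolding inner_A_self by (intro sum_nonneg) auto

lemma norm_orth_proj_le: "i \<in> I \<Longrightarrow> (norm (orth_proj (H i) x))\<^sup>2 \<le> inner (A x) x"
  unfolding inner_A_self using fin by (intro member_le_sum) auto

lemma range_A_subset: "range A \<subseteq> S"
proof
  fix y assume "y \<in> range A"
  then obtain x where "y = (\<Sum>i\<in>I. orth_proj (H i) x)" by (auto simp: A_def)
  then show "y \<in> S"
    unfolding set_sum_alt[OF fin] using orth_proj_mem[OF sub] by blast
qed

lemma csubspace_S: "csubspace S"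
  using sub by (intro csubspace_sum fin) (simp add: closed_csubspace_def)

lemma subset_S: "i \<in> I \<Longrightarrow> H i \<subseteq> S"
proof
  fix x assume i: "i \<in> I" "x \<in> H i"
  have "x = (\<Sum>j\<in>I. if j = i then x else 0)"
    using fin i by (simp add: sum.delta)
  moreover have "\<forall>j\<in>I. (if j = i then x else 0) \<in> H j"
    using i sub by (auto simp: closed_csubspace_def complex_vector.subspace_0)
  ultimately show "x \<in> S"
    unfolding set_sum_alt[OF fin] by blast
qed

section \<open>From a closed sum to the form bound\<close>

text \<open>Closedness provides the projection onto \<open>S\<close>, so pairing \<open>x\<close> in
  \<open>S\<close> with any \<open>y\<close> sees only a finite sum of vectors from the
  \<open>H i\<close>. The form controls each such pairing, and uniform boundedness followed by
  scaling gives \<open>C\<close>.\<close>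

lemma norm_le_of_closed_S:
  assumes "closed S"
  obtains C where "C > 0" "\<And>x. x \<in> S \<Longrightarrow> norm x \<le> C * sqrt (inner (A x) x)"
proof -
  have cS: "closed_csubspace S" using assms csubspace_S by (simp add: closed_csubspace_def)
  define F where "F = {x \<in> S. inner (A x) x \<le> 1}"
  have "\<exists>K. \<forall>x\<in>F. \<bar>inner x y\<bar> \<le> K" for y
  proof -
    have "orth_proj S y \<in> S" by (rule orth_proj_mem[OF cS])
    then obtain s where s: "orth_proj S y = sum s I" "\<And>i. i \<in> I \<Longrightarrow> s i \<in> H i"
      unfolding set_sum_alt[OF fin] by auto
    have "\<bar>inner x y\<bar> \<le> (\<Sum>i\<in>I. norm (s i))" if "x \<in> F" for x
    proof -
      have x: "x \<in> S" "inner (A x) x \<le> 1" using that by (auto simp: F_def)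
      have "inner x y = inner x (sum s I)"
        using inner_orth_proj_left[OF cS x(1), of y] s(1) by (simp add: inner_commute)
      also have "\<dots> = (\<Sum>i\<in>I. inner (orth_proj (H i) x) (s i))"
        unfolding inner_sum_right using s(2) sub by (intro sum.cong) (auto simp: inner_orth_proj_left)
      also have "\<bar>\<dots>\<bar> \<le> (\<Sum>i\<in>I. \<bar>inner (orth_proj (H i) x) (s i)\<bar>)" by (rule sum_abs)
      also have "\<dots> \<le> (\<Sum>i\<in>I. norm (s i))"
      proof (rule sum_mono)
        fix i assume "i \<in> I"
        then have "(norm (orth_proj (H i) x))\<^sup>2 \<le> 1\<^sup>2" using norm_orth_proj_le[of i x] x(2) by simp
        then have "norm (orth_proj (H i) x) \<le> 1" by (rule power2_le_imp_le) simp
        then have "norm (orth_proj (H i) x) * norm (s i) \<le> norm (s i)"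
          by (simp add: mult_left_le_one_le)
        then show "\<bar>inner (orth_proj (H i) x) (s i)\<bar> \<le> norm (s i)"
          using Cauchy_Schwarz_ineq2 order_trans by blast
      qed
      finally show ?thesis .
    qed
    then show ?thesis by blast
  qed
  then have "bounded F" by (rule weakly_bounded_imp_bounded)
  then obtain C where C: "C > 0" "\<And>x. x \<in> F \<Longrightarrow> norm x \<le> C"
    by (auto simp: bounded_pos)
  have "norm x \<le> C * sqrt (inner (A x) x)" if "x \<in> S" for x
  proof -
    \<comment> \<open>Working with every \<open>e\<close> above the square root avoids dividing by a
      form value that might be zero.\<close>
    have "norm x / C \<le> e" if e: "sqrt (inner (A x) x) < e" for e
    proof -
      have e0: "e > 0" using e inner_A_nonneg[of x] by (meson le_less_trans real_sqrt_ge_zero)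
      have "inner (A x) x \<le> e\<^sup>2"
        using e e0 by (meson less_imp_le real_sqrt_le_iff sqrt_le_D)
      then have "inverse e *\<^sub>R x \<in> F"
        using e0 \<open>x \<in> S\<close> subspace_scale[OF csubspace_imp_subspace[OF csubspace_S]]
        by (simp add: F_def A.scaleR field_simps power2_eq_square)
      then show ?thesis using C(1) C(2)[of "inverse e *\<^sub>R x"] e0 by (simp add: field_simps)
    qed
    then have "norm x / C \<le> sqrt (inner (A x) x)" by (rule dense_ge)
    then show ?thesis using C(1) by (simp add: field_simps)
  qed
  with C(1) show ?thesis by (rule that)
qed

text \<open>\<open>A\<close> vanishes on the orthogonal complement of \<open>S\<close>, so
  \<open>x\<close> may be replaced by its projection \<open>u\<close>. Cauchy-Schwarz and coercivity
  on \<open>S\<close> then give \<open>b \<le> a * C * sqrt b\<close>.\<close>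

lemma form_bound_of_closed_S:
  assumes "closed S"
  obtains \<delta> where "\<delta> > 0" "\<And>x. \<delta> * inner (A x) x \<le> (norm (A x))\<^sup>2"
proof -
  have cS: "closed_csubspace S" using assms csubspace_S by (simp add: closed_csubspace_def)
  obtain C where C: "C > 0" "\<And>x. x \<in> S \<Longrightarrow> norm x \<le> C * sqrt (inner (A x) x)"
    using norm_le_of_closed_S[OF assms] by blast
  have "inverse (C\<^sup>2) * inner (A x) x \<le> (norm (A x))\<^sup>2" for x
  proof -
    define u where "u = orth_proj S x"
    have u: "u \<in> S" unfolding u_def by (rule orth_proj_mem[OF cS])
    \<comment> \<open>\<open>x - u\<close> is orthogonal to \<open>S\<close>, which contains
      \<open>H i\<close>.\<close>
    have "orth_proj (H i) (x - u) = 0" if "i \<in> I" for i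
      using sub[OF that] cinner_diff_orth_proj[OF cS] subset_S[OF that]
      by (intro orth_proj_eqI) (auto simp: u_def closed_csubspace_def complex_vector.subspace_0)
    then have "A (x - u) = 0" by (simp add: A_def)
    then have Au: "A u = A x" by (simp add: A.diff)
    define a b where "a = norm (A x)" and "b = inner (A x) x"
    have b0: "b \<ge> 0" by (simp add: b_def inner_A_nonneg)
    have b: "b = inner (A x) u"
    proof -
      have "A x \<in> S" using range_A_subset by blast
      then show ?thesis
        using inner_orth_proj_left[OF cS, of "A x" x] by (simp add: b_def u_def inner_commute)
    qed
    then have "norm u \<le> C * sqrt b" using C(2)[OF u] by (simp add: Au)
    then have "b \<le> a * (C * sqrt b)"
      using b norm_cauchy_schwarz[of "A x" u] mult_left_mono[of "norm u" "C * sqrt b" a]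
      by (simp add: a_def)
    then have "sqrt b * sqrt b \<le> (a * C) * sqrt b" using b0 by (simp add: mult_ac)
    then have "sqrt b \<le> a * C"
      using C(1) b0 mult_right_le_imp_le[of "sqrt b" "sqrt b" "a * C"]
      by (cases "b = 0") (simp_all add: a_def)
    then have "(sqrt b)\<^sup>2 \<le> (a * C)\<^sup>2" using b0 by (intro power_mono) auto
    then show ?thesis
      using C(1) b0 by (simp add: a_def b_def field_simps power_mult_distrib)
  qed
  with C(1) show ?thesis by (intro that[of "inverse (C\<^sup>2)"]) auto
qed

section \<open>From the form bound to a closed sum\<close>

lemma closed_S_of_form_bound:
  assumes d: "\<delta> > 0" "\<And>x. \<delta> * inner (A x) x \<le> (norm (A x))\<^sup>2"
  shows "closed S"
proof -
  \<comment> \<open>Nonnegativity of the form at \<open>x - inverse \<delta> *\<^sub>R A x\<close>,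
    combined with the hypothesis, gives
    \<open>\<delta> * (norm (A x))\<^sup>2 \<le> inner (A (A x)) (A x)\<close>.\<close>
  have range: "\<delta> * norm (A x) \<le> norm (A (A x))" for x
  proof -
    define t where "t = inverse \<delta>"
    have "0 \<le> inner (A (x - t *\<^sub>R A x)) (x - t *\<^sub>R A x)" by (rule inner_A_nonneg)
    also have "\<dots> = inner (A x) x - 2 * t * (norm (A x))\<^sup>2 + t\<^sup>2 * inner (A (A x)) (A x)"
      by (simp add: A.diff A.scaleR inner_diff_left inner_diff_right
          A_selfadjoint[of "A x" x] dot_square_norm power2_eq_square algebra_simps)
    also have "inner (A x) x \<le> t * (norm (A x))\<^sup>2"
      using d by (simp add: t_def field_simps)
    finally have "t * (norm (A x))\<^sup>2 \<le> t\<^sup>2 * inner (A (A x)) (A x)" by simp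
    then have "\<delta> * (norm (A x))\<^sup>2 \<le> inner (A (A x)) (A x)"
      using d(1) by (simp add: t_def field_simps power2_eq_square)
    also have "\<dots> \<le> norm (A (A x)) * norm (A x)" by (rule norm_cauchy_schwarz)
    finally show ?thesis by (cases "A x = 0") (auto simp: power2_eq_square)
  qed
  \<comment> \<open>The bound on the range extends to its closure by continuity. As \<open>N\<close>
    is complete, so is its image under \<open>A\<close>.\<close>
  define N where "N = closure (range A)"
  have N: "csubspace N"
    unfolding N_def by (intro csubspace_closure csubspace_image A_bounded_clinear) simp
  have "closed {y. \<delta> * norm y \<le> norm (A y)}"
    by (intro closed_Collect_le continuous_intros linear_continuous_on A.bounded_linear_axioms)
  then have lower: "\<delta> * norm y \<le> norm (A y)" if "y \<in> N" for y
    using that closure_minimal[of "range A" "{y. \<delta> * norm y \<le> norm (A y)}"] range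
    by (auto simp: N_def)
  have "complete (A ` N)"
    using d(1) lower
    by (intro complete_isometric_image[of \<delta>] csubspace_imp_subspace N A.bounded_linear_axioms)
      (auto simp: N_def complete_eq_closed)
  then have R: "closed_csubspace (A ` N)"
    by (simp add: closed_csubspace_def complete_imp_closed csubspace_image[OF A_bounded_clinear N])
  \<comment> \<open>The residual \<open>w\<close> of \<open>s\<close> is orthogonal to
    \<open>A (A w)\<close>, so \<open>A w = 0\<close>. The form dominates each projection, hence
    \<open>w\<close> is orthogonal to \<open>H i\<close>, in particular to \<open>s\<close>. Being
    orthogonal to \<open>p\<close> as well, \<open>w\<close> is orthogonal to itself.\<close>
  have "H i \<subseteq> A ` N" if i: "i \<in> I" for i
  proof
    fix s assume s: "s \<in> H i"
    define p where "p = orth_proj (A ` N) s"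
    define w where "w = s - p"
    have p: "p \<in> A ` N" unfolding p_def by (rule orth_proj_mem[OF R])
    have orth: "inner w z = 0" if "z \<in> A ` N" for z
      using cinner_diff_orth_proj[OF R that] by (simp add: w_def p_def inner_eq_Re_cinner)
    have AwN: "A w \<in> N" unfolding N_def by (rule subsetD[OF closure_subset rangeI])
    then have "inner (A w) (A w) = 0" 
      using orth[of "A (A w)"] A_selfadjoint[of w "A w"] by simp
    then have "A w = 0" by simp
    then have "orth_proj (H i) w = 0" using norm_orth_proj_le[OF i, of w] by simp
    then have "inner w s = 0" using inner_orth_proj_left[OF sub[OF i] s, of w] by simp
    then have "inner w w = 0" using orth[OF p] by (simp add: w_def inner_diff_right)
    then show "s \<in> A ` N" using p by (simp add: w_def)
  qed
  then have "S \<subseteq> A ` N"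
    unfolding set_sum_alt[OF fin] using R
    by (auto simp: closed_csubspace_def intro!: complex_vector.subspace_sum)
  then have "S = A ` N" using range_A_subset by blast
  then show ?thesis using R by (simp add: closed_csubspace_def)
qed

lemma closed_S_iff_gap:
  "closed S \<longleftrightarrow> (\<exists>\<epsilon>::real. \<epsilon> > 0 \<and> spectrum A \<inter> complex_of_real ` {0<..<\<epsilon>} = {})"
proof
  note spec = not_in_spectrum_selfadjoint_iff[OF A_bounded_clinear A_selfadjoint]
  \<comment> \<open>By this expansion, \<open>t * norm x \<le> norm (A x - t *\<^sub>R x)\<close> is
    the form bound with constant \<open>2 * t\<close>; hence the factors of two below.\<close>
  have sq: "(norm (A x - t *\<^sub>R x))\<^sup>2 = (norm (A x))\<^sup>2 - 2 * t * inner (A x) x + (t * norm x)\<^sup>2"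
    for x t
    by (simp add: power2_norm_eq_inner inner_diff_left inner_diff_right inner_commute
        power_mult_distrib) (simp add: power2_eq_square)
  {
    assume "closed S"
    then obtain \<delta> where d: "\<delta> > 0" "\<And>x. \<delta> * inner (A x) x \<le> (norm (A x))\<^sup>2"
      using form_bound_of_closed_S by blast
    have "complex_of_real t \<notin> spectrum A" if t: "0 < t" "t < \<delta> / 2" for t
    proof -
      have "t * norm x \<le> norm (A x - t *\<^sub>R x)" for x
      proof (rule power2_le_imp_le)
        have "2 * t * inner (A x) x \<le> \<delta> * inner (A x) x"
          using t inner_A_nonneg[of x] by (intro mult_right_mono) auto
        then show "(t * norm x)\<^sup>2 \<le> (norm (A x - t *\<^sub>R x))\<^sup>2"
          using d(2)[of x] unfolding sq by linarith
      qed simp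
      then show ?thesis using t(1) spec by blast
    qed
    then show "\<exists>\<epsilon>>0. spectrum A \<inter> complex_of_real ` {0<..<\<epsilon>} = {}"
      using d(1) by (intro exI[of _ "\<delta> / 2"]) auto
  next
    assume "\<exists>\<epsilon>>0. spectrum A \<inter> complex_of_real ` {0<..<\<epsilon>} = {}"
    then obtain \<epsilon> :: real where e: "\<epsilon> > 0" "spectrum A \<inter> complex_of_real ` {0<..<\<epsilon>} = {}"
      by blast
    \<comment> \<open>The gap is read as an interval centred at \<open>\<epsilon> / 2\<close>, so
      that the lower bound at its centre yields the form bound with constant
      \<open>\<epsilon>\<close>.\<close>
    have "\<exists>c>0. \<forall>x. c * norm x \<le> norm (A x - t *\<^sub>R x)" if "0 < t" "t < 2 * (\<epsilon> / 2)" for t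
      using that e(2) by (intro spec[THEN iffD1]) auto
    then have lower: "\<epsilon> / 2 * norm x \<le> norm (A x - (\<epsilon> / 2) *\<^sub>R x)" for x
      using e(1)
      by (intro selfadjoint_bounded_below_of_gap A.bounded_linear_axioms A_selfadjoint) auto
    have "\<epsilon> * inner (A x) x \<le> (norm (A x))\<^sup>2" for x
      using power_mono[OF lower[of x], of 2] e(1) unfolding sq by simp
    with e(1) show "closed S" by (rule closed_S_of_form_bound)
  }
qed

end

theorem mainTheorem4:
  fixes H :: "nat \<Rightarrow> 'a::chilbert_space set" and n :: nat
  assumes "n \<ge> 2"
    and "\<And>i. i \<in> {1..n} \<Longrightarrow> closed_csubspace (H i)"
  shows "closed (\<Sum>i=1..n. H i) \<longleftrightarrow>
    (\<exists>\<epsilon>::real. \<epsilon> > 0 \<and>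
      spectrum (\<lambda>x. \<Sum>i=1..n. orth_proj (H i) x) \<inter> complex_of_real ` {0<..<\<epsilon>} = {})"
proof -
  interpret projection_sum H "{1..n}"
    using assms(2) by unfold_locales auto
  show ?thesis using closed_S_iff_gap unfolding A_def[abs_def] .
qed

end
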